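(* The series of the inverses of the Mersenne primes converges, i.e. $$\lim_{x \to \infty} \left( \sum_{M_\rho \le x} \frac{1}{M_\rho}\right) < \infty,$$ where the sum runs over all Mersenne primes $M_\rho \le x$.
   Context: A Mersenne prime is a prime number of the form $M_\rho = 2^{\rho}-1$ with $\rho$ a prime number. *)

theory Defs
  imports Complex_Main "HOL-Computational_Algebra.Primes"
begin

definition mersenne_prime :: "nat \<Rightarrow> bool" where
  "mersenne_prime M \<longleftrightarrow> prime M \<and> (\<exists>\<rho>::nat. prime \<rho> \<and> M = 2 ^ \<rho> - 1)"

end

theory Submission
  imports Defs
begin

text \<open>
  Mersenne primes are numbers \<open>2 ^ k - 1\<close>, so their reciprocals are dominated termwise by the
  geometric series with terms \<open>2 / 2 ^ k\<close>. This bounds every partial sum by 4 (\<open>sum_inverse_mersenne_primes_le\<close>), and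
  the partial sums increase with the cutoff, so they tend to their supremum
  (\<open>tendsto_SUP_at_top_if_mono\<close>).
\<close>

lemma tendsto_SUP_at_top_if_mono:
  fixes f :: "real \<Rightarrow> real"
  assumes "mono f" and bdd: "bdd_above (range f)"
  shows "(f \<longlongrightarrow> (SUP x. f x)) at_top"
proof (rule increasing_tendsto)
  show "\<forall>\<^sub>F x in at_top. f x \<le> (SUP x. f x)"
    by (intro always_eventually allI cSUP_upper bdd) simp
next
  fix y assume "y < (SUP x. f x)"
  then obtain x0 where "y < f x0"
    using less_cSUP_iff[OF _ bdd] by auto
  moreover have "f x0 \<le> f x" if "x0 \<le> x" for x
    using \<open>mono f\<close> that by (rule monoD)
  ultimately show "\<forall>\<^sub>F x in at_top. y < f x"
    unfolding eventually_at_top_linorder by (meson less_le_trans)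
qed

text \<open>
  The bound also covers \<open>k = 0\<close>, where the left-hand side is \<open>1 / 0 = 0\<close>; sums over exponents
  can therefore start at 0.
\<close>

lemma inverse_mersenne_number_le: "1 / real (2 ^ k - 1) \<le> 2 * (1 / 2) ^ k"
proof (cases k)
  case (Suc j)
  have "(2::real) ^ j \<le> real (2 ^ k - 1)"
    by (simp add: Suc of_nat_diff)
  then have "1 / real (2 ^ k - 1) \<le> 1 / 2 ^ j"
    by (intro frac_le) simp_all
  then show ?thesis
    by (simp add: Suc power_one_over)
qed simp

lemma finite_nat_real_le: "finite {n::nat. P n \<and> real n \<le> x}"
  by (rule finite_subset[of _ "{..nat \<lfloor>x\<rfloor>}"]) (auto simp: le_nat_floor)

lemma sum_inverse_mersenne_primes_le:
  "(\<Sum>M | mersenne_prime M \<and> real M \<le> x. 1 / real M) \<le> 4"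
proof -
  define m where "m = (\<lambda>k::nat. 2 ^ k - 1 :: nat)"
  \<comment> \<open>Since \<open>k \<le> 2 ^ k - 1\<close>, the cutoff on the Mersenne number also bounds its exponent.\<close>
  define K where "K = {..<Suc (nat \<lfloor>x\<rfloor>)}"
  have "{M. mersenne_prime M \<and> real M \<le> x} \<subseteq> m ` K"
  proof
    fix M assume "M \<in> {M. mersenne_prime M \<and> real M \<le> x}"
    then obtain k where k: "M = 2 ^ k - 1" and "real M \<le> x"
      by (auto simp: mersenne_prime_def)
    then have "M \<le> nat \<lfloor>x\<rfloor>"
      by (simp add: le_nat_floor)
    moreover have "k \<le> M"
      using less_exp[of k] unfolding k by linarith
    ultimately have "k \<in> K"
      by (simp add: K_def)
    then show "M \<in> m ` K"
      by (auto simp: m_def k)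
  qed
  then have "(\<Sum>M | mersenne_prime M \<and> real M \<le> x. 1 / real M) \<le> (\<Sum>M\<in>m ` K. 1 / real M)"
    by (intro sum_mono2) (auto simp: K_def)
  also have "\<dots> \<le> sum ((\<lambda>M. 1 / real M) \<circ> m) K"
    by (rule sum_image_le) (auto simp: K_def)
  also have "\<dots> \<le> (\<Sum>k\<in>K. 2 * (1 / 2) ^ k)"
    using inverse_mersenne_number_le by (auto intro: sum_mono simp: m_def)
  also have "\<dots> = 2 * (\<Sum>k\<in>K. (1 / 2) ^ k)"
    by (simp add: sum_distrib_left)
  also have "\<dots> \<le> 2 * (\<Sum>k. (1 / 2) ^ k)"
    by (intro mult_left_mono sum_le_suminf summable_geometric) (auto simp: K_def)
  also have "\<dots> = 4"
    by (simp add: suminf_geometric)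
  finally show ?thesis .
qed

theorem theorem22:
  "\<exists>L::real. ((\<lambda>x::real. \<Sum>M | mersenne_prime M \<and> real M \<le> x. 1 / real M) \<longlongrightarrow> L) at_top"
proof (rule exI, rule tendsto_SUP_at_top_if_mono)
  show "mono (\<lambda>x::real. \<Sum>M | mersenne_prime M \<and> real M \<le> x. 1 / real M)"
    by (intro monoI sum_mono2 finite_nat_real_le) auto
  show "bdd_above (range (\<lambda>x::real. \<Sum>M | mersenne_prime M \<and> real M \<le> x. 1 / real M))"
    using sum_inverse_mersenne_primes_le by (intro bdd_aboveI2)
qed

end
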